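(* Let $(G,.)$ be a group and let $M$ be a set endowed with a right action $M\times G\to M$, $(m,a)\mapsto ma$, of $G$. Let $\mathcal G:=G^M$ be the set of maps from $M$ into $G$, endowed with the pointwise product $(f.g)(m):=f(m).g(m)$ and with the binary map $\rhd:\mathcal G\times\mathcal G\to\mathcal G$ defined by $$(f\rhd g)(m):=g\big(mf(m)\big)$$ for $f,g\in\mathcal G$ and $m\in M$. Then the triple $(\mathcal G,.,\rhd)$ is a weak post-group, and its Grossman--Larson product is given by $$(f*g)(m)=f(m).g\big(mf(m)\big)$$ for all $f,g\in\mathcal G$ and $m\in M$.
   Context: A weak post-group is a triple $(H,.,\rhd)$ where $(H,.)$ is a group with unit $e$ and $\rhd:H\times H\to H$ is a binary map such that: (i) for every $a\in H$ the left multiplication operator $L_a^\rhd:=a\rhd -:H\to H$ is a group morphism (not necessarily bijective); (ii) $(a*b)\rhd c=a\rhd(b\rhd c)$ for all $a,b,c\in H$, where $a*b:=a.(a\rhd b)$; (iii) $L_e^\rhd$ is bijective. The product $a*b:=a.(a\rhd b)$ is called the Grossman--Larson product of the weak post-group. *)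

theory Defs
  imports "HOL-Algebra.Product_Groups"
begin

definition grossman_larson ::
    "('a, 'b) monoid_scheme \<Rightarrow> ('a \<Rightarrow> 'a \<Rightarrow> 'a) \<Rightarrow> 'a \<Rightarrow> 'a \<Rightarrow> 'a"
  where "grossman_larson H tri a b = a \<otimes>\<^bsub>H\<^esub> tri a b"

(* Closure of carrier H under the second operation is part of left_mult_hom, since hom
   requires its elements to map carrier H into itself. *)
locale weak_post_group = group H for H (structure) +
  fixes tri :: "'a \<Rightarrow> 'a \<Rightarrow> 'a"  (infixr \<open>\<rhd>\<close> 75)
  assumes left_mult_hom: "a \<in> carrier H \<Longrightarrow> (\<lambda>b. a \<rhd> b) \<in> hom H H"
    and grossman_larson_act:
      "\<lbrakk>a \<in> carrier H; b \<in> carrier H; c \<in> carrier H\<rbrakk>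
        \<Longrightarrow> grossman_larson H (\<rhd>) a b \<rhd> c = a \<rhd> (b \<rhd> c)"
    and left_mult_one_bij: "bij_betw (\<lambda>b. \<one> \<rhd> b) (carrier H) (carrier H)"

(* The library's group_action is a left action. *)
locale right_group_action = group G for G (structure) +
  fixes M :: "'m set" and act :: "'m \<Rightarrow> 'a \<Rightarrow> 'm"
  assumes act_closed: "\<lbrakk>m \<in> M; a \<in> carrier G\<rbrakk> \<Longrightarrow> act m a \<in> M"
    and act_one: "m \<in> M \<Longrightarrow> act m \<one> = m"
    and act_mult:
      "\<lbrakk>m \<in> M; a \<in> carrier G; b \<in> carrier G\<rbrakk> \<Longrightarrow> act (act m a) b = act m (a \<otimes> b)"

(* Maps on M are restricted to M (and undefined elsewhere), so that they are elements of
   the carrier of product_group. *)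
definition map_tri ::
    "'m set \<Rightarrow> ('m \<Rightarrow> 'a \<Rightarrow> 'm) \<Rightarrow> ('m \<Rightarrow> 'a) \<Rightarrow> ('m \<Rightarrow> 'a) \<Rightarrow> ('m \<Rightarrow> 'a)"
  where "map_tri M act f g = (\<lambda>m\<in>M. g (act m (f m)))"

end

theory Submission
  imports Defs
begin

text \<open>Each \<open>f\<close> induces a self-map \<phi>_f of \<open>M\<close>, sending
  \<open>m\<close> to \<open>act m (f m)\<close>, and \<open>map_tri M act f g\<close> is the
  composite of \<open>g\<close> with \<phi>_f. Precomposition respects pointwise products, whence
  \<open>map_tri_hom\<close>; \<phi>_f is the identity when \<open>f\<close> is the unit, whence
  \<open>map_tri_one\<close>. The action law gives \<phi>_(f*g) = \<phi>_g o \<phi>_f for the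
  Grossman-Larson product *, and precomposing \<open>h\<close> with both sides yields
  \<open>map_tri_grossman_larson\<close>.\<close>

context right_group_action
begin

lemma map_tri_apply:
  "m \<in> M \<Longrightarrow> map_tri M act f g m = g (act m (f m))"
  by (simp add: map_tri_def)

lemma act_closed_fun:
  "\<lbrakk>f \<in> carrier (product_group M (\<lambda>_. G)); m \<in> M\<rbrakk> \<Longrightarrow> act m (f m) \<in> M"
  by (auto intro!: act_closed)

lemma map_tri_hom:
  assumes "f \<in> carrier (product_group M (\<lambda>_. G))"
  shows "map_tri M act f \<in> hom (product_group M (\<lambda>_. G)) (product_group M (\<lambda>_. G))"
  using act_closed_fun[OF assms]
  by (auto simp: hom_def map_tri_def intro!: restrict_ext)

text \<open>On \<open>M\<close> this is triviality of the action of the unit; off \<open>M\<close>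
  it rests on \<open>f\<close> being extensional, as a member of the carrier.\<close>

lemma map_tri_one:
  assumes "f \<in> carrier (product_group M (\<lambda>_. G))"
  shows "map_tri M act \<one>\<^bsub>product_group M (\<lambda>_. G)\<^esub> f = f"
  using assms by (auto simp: map_tri_def act_one PiE_iff intro: extensionalityI[of _ M])

lemma grossman_larson_apply:
  "m \<in> M \<Longrightarrow>
    grossman_larson (product_group M (\<lambda>_. G)) (map_tri M act) f g m = f m \<otimes> g (act m (f m))"
  by (simp add: grossman_larson_def map_tri_apply)

lemma map_tri_grossman_larson:
  assumes f: "f \<in> carrier (product_group M (\<lambda>_. G))"
    and g: "g \<in> carrier (product_group M (\<lambda>_. G))"
  shows "map_tri M act (grossman_larson (product_group M (\<lambda>_. G)) (map_tri M act) f g) h =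
    map_tri M act f (map_tri M act g h)"
proof
  fix m
  show "map_tri M act (grossman_larson (product_group M (\<lambda>_. G)) (map_tri M act) f g) h m =
    map_tri M act f (map_tri M act g h) m"
  proof (cases "m \<in> M")
    case True
    have mf: "act m (f m) \<in> M"
      using f True by (rule act_closed_fun)
    have "f m \<in> carrier G" "g (act m (f m)) \<in> carrier G"
      using f g True mf by auto
    then show ?thesis
      \<comment> \<open>\<open>mf\<close> allows the inner \<open>map_tri M act g h\<close> to be
        evaluated at the moved point; \<open>act_mult\<close> then identifies the two arguments of
        \<open>h\<close>.\<close>
      using True mf by (simp add: map_tri_apply grossman_larson_apply act_mult)
  \<comment> \<open>Off \<open>M\<close> both sides are \<open>undefined\<close>.\<close>
  qed (simp add: map_tri_def)
qed

lemma weak_post_group_map_tri: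
  "weak_post_group (product_group M (\<lambda>_. G)) (map_tri M act)"
proof (intro weak_post_group.intro weak_post_group_axioms.intro)
  show "group (product_group M (\<lambda>_. G))"
    by (simp add: is_group)
  show "bij_betw (map_tri M act \<one>\<^bsub>product_group M (\<lambda>_. G)\<^esub>)
      (carrier (product_group M (\<lambda>_. G))) (carrier (product_group M (\<lambda>_. G)))"
    \<comment> \<open>On the carrier, left multiplication by the unit coincides with
      \<open>id\<close>.\<close>
    using bij_betw_id by (subst bij_betw_cong[where g = id]) (auto simp only: map_tri_one id_apply)
\<comment> \<open>Carriers stay folded so that the premises of the two lemmas match.\<close>
qed (auto intro: map_tri_hom map_tri_grossman_larson simp del: carrier_product_group)

end

theorem theorem9:
  fixes G :: "('a, 'b) monoid_scheme" and M :: "'m set" and act :: "'m \<Rightarrow> 'a \<Rightarrow> 'm"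
  assumes "group G"
    and "right_group_action G M act"
  defines "\<G> \<equiv> product_group M (\<lambda>_. G)"
  shows "weak_post_group \<G> (map_tri M act) \<and>
    (\<forall>f\<in>carrier \<G>. \<forall>g\<in>carrier \<G>. \<forall>m\<in>M.
      grossman_larson \<G> (map_tri M act) f g m = f m \<otimes>\<^bsub>G\<^esub> g (act m (f m)))"
  using right_group_action.weak_post_group_map_tri[OF assms(2)]
    right_group_action.grossman_larson_apply[OF assms(2)]
  unfolding \<G>_def by blast

end
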